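(* Let $\mathcal{P}:H^t_g\to H^{-s}$ be continuous, let $\xi\in H^{-s}$, and let the kernel $K$ be such that the embeddings $\mathcal{H}_K\hookrightarrow C(\overline{\Omega})$ and $\mathcal{H}_K\hookrightarrow H^t$ are compact. Let $\gamma>0$, let $$J(u;\gamma):=\|\mathcal{P}(u)-\xi\|_{H^{-s}}^2+\gamma\|u\|_{\mathcal{H}_K}^2,$$ and let $$m:=\inf\{J(u;\gamma)\;:\;u\in\mathcal{H}_K,\ u=g\text{ on }\partial\Omega\}.$$ Then $0\le m<\infty$ and there exists $u_\infty\in\mathcal{H}_K$ with $u_\infty=g$ on $\partial\Omega$ such that $m=J(u_\infty;\gamma)$. Moreover, if $(u_n)_{n\in\mathbb{N}}$ is a minimizing sequence (that is, $u_n\in\mathcal{H}_K$, $u_n=g$ on $\partial\Omega$ and $J(u_n;\gamma)\to m$), then there is a subsequence which converges strongly in $\mathcal{H}_K$ to some $\bar u_\infty$ (possibly distinct from $u_\infty$), satisfying the boundary condition, such that $m=J(\bar u_\infty;\gamma)$. Therefore, if the minimizer of $J(\cdot;\gamma)$ under the constraint $u=g$ on $\partial\Omega$ is unique, then the entire sequence $u_n$ converges to $u_\infty$.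
   Context: $\Omega\subset\mathbb{R}^d$ is a bounded open domain with Lipschitz boundary; all function spaces are over $\Omega$. $s>0$ and $t>\frac12$, with moreover $t>\frac d2$ so that the boundary condition can be interpreted pointwise. $H^t$ is the Sobolev space; $H^s_0$ is the closure in $H^s$ of the smooth compactly supported functions; $H^{-s}$ is the dual of $H^s_0$ with respect to the $L^2$ duality. For fixed continuous boundary data $g\in H^{t-1/2}(\partial\Omega)$, $H^t_g$ is the set of $u\in H^t$ whose trace on $\partial\Omega$ is $g$. $\mathcal{P}$ is a possibly nonlinear differential operator. $K:\overline\Omega\times\overline\Omega\to\mathbb{R}$ is a kernel with reproducing kernel Hilbert space (RKHS) $\mathcal{H}_K$. Standing assumption: at least one $u\in\mathcal{H}_K$ satisfies $u=g$ on $\partial\Omega$ (pointwise). *)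

theory Defs
  imports "HOL-Analysis.Analysis"
begin

section \<open>Lipschitz domains\<close>

text \<open>Near each boundary point, in the direction of a unit vector \<open>\<nu>\<close>, the set is the part of a
  ball lying strictly above the graph of a Lipschitz function of the component orthogonal to \<open>\<nu>\<close>.
  A Lipschitz function on the hyperplane extends to the whole space by composition with the
  projection, so \<open>h\<close> may be taken to be defined everywhere.\<close>

definition lipschitz_boundary :: "(real^'n) set \<Rightarrow> bool" where
  "lipschitz_boundary \<Omega> \<longleftrightarrow>
     (\<forall>x0 \<in> frontier \<Omega>. \<exists>r > 0. \<exists>\<nu>. \<exists>L. \<exists>h :: real^'n \<Rightarrow> real.
        norm \<nu> = 1 \<and> L-lipschitz_on UNIV h \<and>
        \<Omega> \<inter> ball x0 r = {x \<in> ball x0 r. x \<bullet> \<nu> > h (x - (x \<bullet> \<nu>) *\<^sub>R \<nu>)})"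

definition bounded_lipschitz_domain :: "(real^'n) set \<Rightarrow> bool" where
  "bounded_lipschitz_domain \<Omega> \<longleftrightarrow>
     open \<Omega> \<and> connected \<Omega> \<and> \<Omega> \<noteq> {} \<and> bounded \<Omega> \<and> lipschitz_boundary \<Omega>"


section \<open>Test functions and weak derivatives\<close>

text \<open>A list \<open>\<alpha>\<close> of coordinate indices stands for the iterated derivative in these directions.\<close>

primrec partials :: "'n list \<Rightarrow> (real^'n \<Rightarrow> real) \<Rightarrow> real^'n \<Rightarrow> real" where
  "partials [] f = f"
| "partials (i # \<alpha>) f = (\<lambda>x. frechet_derivative (partials \<alpha> f) (at x) (axis i 1))"

definition smooth :: "(real^'n \<Rightarrow> real) \<Rightarrow> bool" where
  "smooth f \<longleftrightarrow> (\<forall>\<alpha> x. partials \<alpha> f differentiable (at x))"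

definition test_functions :: "(real^'n) set \<Rightarrow> (real^'n \<Rightarrow> real) set" where
  "test_functions \<Omega> =
     {\<phi>. smooth \<phi> \<and> compact (closure {x. \<phi> x \<noteq> 0}) \<and> closure {x. \<phi> x \<noteq> 0} \<subseteq> \<Omega>}"

definition L2 :: "(real^'n) set \<Rightarrow> (real^'n \<Rightarrow> real) set" where
  "L2 \<Omega> = {u. u \<in> borel_measurable (lebesgue_on \<Omega>) \<and>
                integrable (lebesgue_on \<Omega>) (\<lambda>x. (u x)\<^sup>2)}"

definition has_weak_partial ::
    "(real^'n) set \<Rightarrow> 'n list \<Rightarrow> (real^'n \<Rightarrow> real) \<Rightarrow> (real^'n \<Rightarrow> real) \<Rightarrow> bool" where
  "has_weak_partial \<Omega> \<alpha> u w \<longleftrightarrow> u \<in> L2 \<Omega> \<and> w \<in> L2 \<Omega> \<and>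
     (\<forall>\<phi> \<in> test_functions \<Omega>.
        (LINT x|lebesgue_on \<Omega>. u x * partials \<alpha> \<phi> x) =
        (- 1) ^ length \<alpha> * (LINT x|lebesgue_on \<Omega>. w x * \<phi> x))"

text \<open>Weak derivatives are unique almost everywhere only; all uses below are insensitive to the
  choice of the representative (the one of \<open>u\<close> itself, for \<open>\<alpha> = []\<close>, included).\<close>

definition weak_partial :: "(real^'n) set \<Rightarrow> 'n list \<Rightarrow> (real^'n \<Rightarrow> real) \<Rightarrow> real^'n \<Rightarrow> real" where
  "weak_partial \<Omega> \<alpha> u = (SOME w. has_weak_partial \<Omega> \<alpha> u w)"


section \<open>Sobolev spaces of real order\<close>

text \<open>These are the Sobolev--Slobodeckij spaces: for \<open>t = k + \<sigma>\<close> with \<open>k\<close> a natural number and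
  \<open>0 \<le> \<sigma> < 1\<close>, all weak derivatives up to order \<open>k\<close> are square integrable and, if \<open>\<sigma> > 0\<close>, those
  of order \<open>k\<close> have a finite Gagliardo seminorm of order \<open>\<sigma>\<close>.  As usual, functions stand for their
  classes modulo equality almost everywhere on \<open>\<Omega>\<close>: the spaces are sets of representatives, closed
  under such changes, and \<open>sobolev_norm\<close> is a norm on the classes.  The sums run over all lists of
  coordinate indices, so the derivative of order \<open>j\<close> enters with its full Frobenius norm.\<close>

definition gagliardo_integrand :: "real \<Rightarrow> (real^'n \<Rightarrow> real) \<Rightarrow> (real^'n) \<times> (real^'n) \<Rightarrow> real" where
  "gagliardo_integrand \<sigma> w =
     (\<lambda>(x, y). (w x - w y)\<^sup>2 / norm (x - y) powr (real CARD('n) + 2 * \<sigma>))"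

definition sobolev_space :: "real \<Rightarrow> (real^'n) set \<Rightarrow> (real^'n \<Rightarrow> real) set" where
  "sobolev_space t \<Omega> = {u \<in> L2 \<Omega>.
     (\<forall>\<alpha>. length \<alpha> \<le> nat \<lfloor>t\<rfloor> \<longrightarrow> (\<exists>w. has_weak_partial \<Omega> \<alpha> u w)) \<and>
     (frac t > 0 \<longrightarrow> (\<forall>\<alpha>. length \<alpha> = nat \<lfloor>t\<rfloor> \<longrightarrow>
        integrable (lebesgue_on \<Omega> \<Otimes>\<^sub>M lebesgue_on \<Omega>)
          (gagliardo_integrand (frac t) (weak_partial \<Omega> \<alpha> u))))}"

definition sobolev_norm :: "real \<Rightarrow> (real^'n) set \<Rightarrow> (real^'n \<Rightarrow> real) \<Rightarrow> real" where
  "sobolev_norm t \<Omega> u = sqrt (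
     (LINT x|lebesgue_on \<Omega>. (u x)\<^sup>2) +
     (\<Sum>\<alpha> | 1 \<le> length \<alpha> \<and> length \<alpha> \<le> nat \<lfloor>t\<rfloor>.
        LINT x|lebesgue_on \<Omega>. (weak_partial \<Omega> \<alpha> u x)\<^sup>2) +
     (if frac t > 0
      then (\<Sum>\<alpha> | length \<alpha> = nat \<lfloor>t\<rfloor>. LINT z|(lebesgue_on \<Omega> \<Otimes>\<^sub>M lebesgue_on \<Omega>).
              gagliardo_integrand (frac t) (weak_partial \<Omega> \<alpha> u) z)
      else 0))"

definition sobolev_space_0 :: "real \<Rightarrow> (real^'n) set \<Rightarrow> (real^'n \<Rightarrow> real) set" where
  "sobolev_space_0 s \<Omega> = {v \<in> sobolev_space s \<Omega>.
     \<exists>\<phi> :: nat \<Rightarrow> real^'n \<Rightarrow> real. (\<forall>n. \<phi> n \<in> test_functions \<Omega>) \<and>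
       (\<lambda>n. sobolev_norm s \<Omega> (\<lambda>x. \<phi> n x - v x)) \<longlonglongrightarrow> 0}"


section \<open>Negative order\<close>

text \<open>The dual of \<open>sobolev_space_0 s \<Omega>\<close>, a square integrable \<open>f\<close> being identified with the functional
  \<open>\<lambda>v. LINT x|lebesgue_on \<Omega>. f x * v x\<close>.  Only the values of a functional on \<open>sobolev_space_0 s \<Omega>\<close>
  matter; linearity and boundedness make it respect equality almost everywhere.\<close>

definition sobolev_dual :: "real \<Rightarrow> (real^'n) set \<Rightarrow> ((real^'n \<Rightarrow> real) \<Rightarrow> real) set" where
  "sobolev_dual s \<Omega> = {l.
     (\<forall>v \<in> sobolev_space_0 s \<Omega>. \<forall>w \<in> sobolev_space_0 s \<Omega>. l (\<lambda>x. v x + w x) = l v + l w) \<and>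
     (\<forall>v \<in> sobolev_space_0 s \<Omega>. \<forall>c. l (\<lambda>x. c * v x) = c * l v) \<and>
     (\<exists>C. \<forall>v \<in> sobolev_space_0 s \<Omega>. \<bar>l v\<bar> \<le> C * sobolev_norm s \<Omega> v)}"

definition sobolev_dual_norm ::
    "real \<Rightarrow> (real^'n) set \<Rightarrow> ((real^'n \<Rightarrow> real) \<Rightarrow> real) \<Rightarrow> real" where
  "sobolev_dual_norm s \<Omega> l =
     (SUP v \<in> {v \<in> sobolev_space_0 s \<Omega>. sobolev_norm s \<Omega> v \<le> 1}. \<bar>l v\<bar>)"


section \<open>Boundary values\<close>

text \<open>Intended for \<open>t > d/2\<close> and Lipschitz \<open>\<Omega>\<close>: there every function in \<open>H\<^sup>t\<close> has exactly one
  representative on \<open>closure \<Omega>\<close> that is continuous up to the boundary, and its trace is the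
  pointwise restriction of that representative.\<close>

definition has_trace :: "(real^'n) set \<Rightarrow> (real^'n \<Rightarrow> real) \<Rightarrow> (real^'n \<Rightarrow> real) \<Rightarrow> bool" where
  "has_trace \<Omega> u g \<longleftrightarrow> (\<exists>v. continuous_on (closure \<Omega>) v \<and>
     (AE x in lebesgue_on \<Omega>. v x = u x) \<and> (\<forall>x \<in> frontier \<Omega>. v x = g x))"

definition sobolev_space_bc ::
    "real \<Rightarrow> (real^'n) set \<Rightarrow> (real^'n \<Rightarrow> real) \<Rightarrow> (real^'n \<Rightarrow> real) set" where
  "sobolev_space_bc t \<Omega> g = {u \<in> sobolev_space t \<Omega>. has_trace \<Omega> u g}"

text \<open>\<open>H\<close> of order \<open>t - 1/2\<close> on the boundary, as the trace space of \<open>H\<^sup>t\<close>, for \<open>t > d/2\<close>.\<close>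

definition boundary_trace_space :: "real \<Rightarrow> (real^'n) set \<Rightarrow> (real^'n \<Rightarrow> real) set" where
  "boundary_trace_space t \<Omega> = {g. \<exists>u \<in> sobolev_space t \<Omega>. has_trace \<Omega> u g}"


section \<open>Continuity and compact embeddings with respect to given (semi)norms\<close>

text \<open>With a seminorm whose null functions are those vanishing almost everywhere, continuity
  includes that \<open>F\<close> is well defined on equivalence classes.\<close>

definition norm_continuous_on ::
    "(('a \<Rightarrow> real) \<Rightarrow> real) \<Rightarrow> (('b \<Rightarrow> real) \<Rightarrow> real) \<Rightarrow> ('a \<Rightarrow> real) set \<Rightarrow>
     (('a \<Rightarrow> real) \<Rightarrow> ('b \<Rightarrow> real)) \<Rightarrow> bool" where
  "norm_continuous_on N N' S F \<longleftrightarrow>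
     (\<forall>u \<in> S. \<forall>\<epsilon> > 0. \<exists>\<delta> > 0. \<forall>v \<in> S.
        N (\<lambda>x. v x - u x) < \<delta> \<longrightarrow> N' (\<lambda>y. F v y - F u y) < \<epsilon>)"

definition compact_embedding ::
    "('a \<Rightarrow> real) set \<Rightarrow> (('a \<Rightarrow> real) \<Rightarrow> real) \<Rightarrow>
     ('a \<Rightarrow> real) set \<Rightarrow> (('a \<Rightarrow> real) \<Rightarrow> real) \<Rightarrow> bool" where
  "compact_embedding V N W N' \<longleftrightarrow> V \<subseteq> W \<and>
     (\<forall>u :: nat \<Rightarrow> 'a \<Rightarrow> real. (\<forall>n. u n \<in> V) \<and> bounded (range (\<lambda>n. N (u n))) \<longrightarrow>
        (\<exists>r :: nat \<Rightarrow> nat. \<exists>w \<in> W. strict_mono r \<and> (\<lambda>n. N' (\<lambda>x. u (r n) x - w x)) \<longlonglongrightarrow> 0))"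

definition continuous_functions :: "'a::topological_space set \<Rightarrow> ('a \<Rightarrow> real) set" where
  "continuous_functions X = {f. continuous_on X f}"

definition sup_norm :: "'a set \<Rightarrow> ('a \<Rightarrow> real) \<Rightarrow> real" where
  "sup_norm X f = (SUP x \<in> X. \<bar>f x\<bar>)"


section \<open>Reproducing kernel Hilbert spaces\<close>

text \<open>\<open>H\<close> with inner product \<open>ip\<close> is the (unique) Hilbert space of real functions on \<open>X\<close> with
  reproducing kernel \<open>K\<close>.  A function on \<open>X\<close> is represented by its extension by zero, so that
  equality in \<open>H\<close> is equality of functions.  Symmetry and positive semidefiniteness of \<open>K\<close> on \<open>X\<close>
  are consequences of the assumptions.\<close>

definition ip_norm :: "(('a \<Rightarrow> real) \<Rightarrow> ('a \<Rightarrow> real) \<Rightarrow> real) \<Rightarrow> ('a \<Rightarrow> real) \<Rightarrow> real" where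
  "ip_norm ip f = sqrt (ip f f)"

locale rkhs =
  fixes X :: "'a set"
    and K :: "'a \<Rightarrow> 'a \<Rightarrow> real"
    and H :: "('a \<Rightarrow> real) set"
    and ip :: "('a \<Rightarrow> real) \<Rightarrow> ('a \<Rightarrow> real) \<Rightarrow> real"
  assumes zero_outside: "f \<in> H \<Longrightarrow> x \<notin> X \<Longrightarrow> f x = 0"
    and zero_mem: "(\<lambda>x. 0) \<in> H"
    and add_mem: "f \<in> H \<Longrightarrow> h \<in> H \<Longrightarrow> (\<lambda>x. f x + h x) \<in> H"
    and scale_mem: "f \<in> H \<Longrightarrow> (\<lambda>x. c * f x) \<in> H"
    and ip_commute: "f \<in> H \<Longrightarrow> h \<in> H \<Longrightarrow> ip f h = ip h f"
    and ip_add: "f \<in> H \<Longrightarrow> h \<in> H \<Longrightarrow> k \<in> H \<Longrightarrow> ip (\<lambda>x. f x + h x) k = ip f k + ip h k"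
    and ip_scale: "f \<in> H \<Longrightarrow> h \<in> H \<Longrightarrow> ip (\<lambda>x. c * f x) h = c * ip f h"
    and ip_nonneg: "f \<in> H \<Longrightarrow> ip f f \<ge> 0"
    and ip_definite: "f \<in> H \<Longrightarrow> ip f f = 0 \<Longrightarrow> f = (\<lambda>x. 0)"
    and complete: "(\<And>n. u n \<in> H) \<Longrightarrow>
      (\<forall>e > 0. \<exists>N::nat. \<forall>m \<ge> N. \<forall>n \<ge> N. ip_norm ip (\<lambda>x. u m x - u n x) < e) \<Longrightarrow>
      \<exists>l \<in> H. (\<lambda>n. ip_norm ip (\<lambda>x. u n x - l x)) \<longlonglongrightarrow> 0"
    and kernel_mem: "x \<in> X \<Longrightarrow> (\<lambda>y. if y \<in> X then K x y else 0) \<in> H"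
    and reproducing: "x \<in> X \<Longrightarrow> f \<in> H \<Longrightarrow> f x = ip f (\<lambda>y. if y \<in> X then K x y else 0)"

end

(* Let u n be a sequence in the RKHS that converges uniformly to v, with norms tending to L.  The
   functions of H within distance 1/(n+1) of v form decreasing convex sets C n; by the parallelogram
   law, almost norm-minimal elements of C n form a Cauchy sequence, whose limit h equals v on X and
   satisfies |h| <= L.  If |h| = L, then u n itself is almost norm-minimal and converges to h
   in norm.  This replaces weak compactness: by the compact embeddings, a minimizing sequence has a
   subsequence of this kind along which the residual converges to that of h, so that
   J h <= m, and minimality forces |h| = L. *)
theory Submission
  imports Defs
begin

section \<open>Reproducing kernel Hilbert spaces\<close>

context rkhs
begin

section \<open>Inner product algebra up to Cauchy-Schwarz\<close>

lemma diff_mem: "f \<in> H \<Longrightarrow> h \<in> H \<Longrightarrow> (\<lambda>x. f x - h x) \<in> H"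
  using add_mem[of f "\<lambda>x. (-1) * h x"] scale_mem[of h "-1"] by simp

lemma ip_diff:
  assumes "f \<in> H" "h \<in> H" "k \<in> H"
  shows "ip (\<lambda>x. f x - h x) k = ip f k - ip h k"
  using ip_add[of f "\<lambda>x. (-1) * h x" k] ip_scale[of h k "-1"] scale_mem[of h "-1"] assms by simp

lemma ip_norm_nonneg: "f \<in> H \<Longrightarrow> ip_norm ip f \<ge> 0"
  by (simp add: ip_norm_def ip_nonneg)

lemma ip_norm_power2: "f \<in> H \<Longrightarrow> (ip_norm ip f)\<^sup>2 = ip f f"
  by (simp add: ip_norm_def ip_nonneg)

lemma ip_self_diff:
  assumes "f \<in> H" "h \<in> H"
  shows "ip (\<lambda>x. f x - h x) (\<lambda>x. f x - h x) = ip f f - 2 * ip f h + ip h h"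
proof -
  let ?d = "\<lambda>x. f x - h x"
  have d: "?d \<in> H" using assms by (rule diff_mem)
  have "ip ?d ?d = ip f ?d - ip h ?d" using assms d by (intro ip_diff)
  also have "\<dots> = ip ?d f - ip ?d h" using assms d ip_commute by simp
  also have "\<dots> = ip f f - 2 * ip f h + ip h h"
    using ip_diff[OF assms assms(1)] ip_diff[OF assms assms(2)] ip_commute[OF assms] by simp
  finally show ?thesis .
qed

lemma ip_self_scale: "f \<in> H \<Longrightarrow> ip (\<lambda>x. c * f x) (\<lambda>x. c * f x) = c\<^sup>2 * ip f f"
  using ip_scale[of f "\<lambda>x. c * f x" c] ip_scale[of f f c] scale_mem[of f c]
    ip_commute[of f "\<lambda>x. c * f x"] by (simp add: power2_eq_square)

text \<open>Expand both sides. The midpoint on the right is there for convexity: if \<open>f\<close>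
  and \<open>h\<close> lie in a convex set, so does the midpoint, and a lower bound for squared
  norms on that set then bounds the distance between \<open>f\<close> and \<open>h\<close>.\<close>

lemma ip_parallelogram:
  assumes "f \<in> H" "h \<in> H"
  shows "ip (\<lambda>x. f x - h x) (\<lambda>x. f x - h x) =
    2 * ip f f + 2 * ip h h - 4 * ip (\<lambda>x. 1/2 * (f x + h x)) (\<lambda>x. 1/2 * (f x + h x))"
proof -
  let ?n = "\<lambda>x. (-1) * h x"
  have n: "?n \<in> H" using assms scale_mem by blast
  have "ip (\<lambda>x. f x + h x) (\<lambda>x. f x + h x) = ip f f + 2 * ip f h + ip h h"
    using ip_self_diff[OF assms(1) n] ip_self_scale[OF assms(2), of "-1"]
      ip_scale[OF assms(2,1), of "-1"] ip_commute[OF assms(1) n] ip_commute[OF assms] by simp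
  then show ?thesis
    using ip_self_scale[OF add_mem[OF assms], of "1/2"] ip_self_diff[OF assms]
    by (simp add: power2_eq_square)
qed

lemma ip_Cauchy_Schwarz:
  assumes f: "f \<in> H" and h: "h \<in> H"
  shows "\<bar>ip f h\<bar> \<le> ip_norm ip f * ip_norm ip h"
proof -
  have "(ip f h)\<^sup>2 \<le> ip f f * ip h h"
  proof (cases "ip h h = 0")
    case True
    \<comment> \<open>Writing the zero function as a multiple of \<open>f\<close> lets
      \<open>ip_scale\<close> evaluate the inner product.\<close>
    then have "h = (\<lambda>x. 0 * f x)" using ip_definite[OF h] by simp
    then have "ip h f = 0" using ip_scale[OF f f, of 0] by simp
    then show ?thesis using True ip_commute[OF f h] by simp
  next
    case False
    then have pos: "ip h h > 0" using ip_nonneg[OF h] by simp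
    \<comment> \<open>\<open>c * h\<close> is the orthogonal projection of \<open>f\<close> onto the
      line through \<open>h\<close>; the claim says that the remainder has nonnegative squared
      norm.\<close>
    define c where "c = ip f h / ip h h"
    have ch: "(\<lambda>x. c * h x) \<in> H" using h by (rule scale_mem)
    have "0 \<le> ip (\<lambda>x. f x - c * h x) (\<lambda>x. f x - c * h x)"
      using ip_nonneg diff_mem[OF f ch] by blast
    also have "\<dots> = ip f f - 2 * (c * ip f h) + c\<^sup>2 * ip h h"
      using ip_self_diff[OF f ch] ip_self_scale[OF h] ip_scale[OF h f, of c]
        ip_commute[OF f ch] ip_commute[OF f h] by simp
    also have "\<dots> = ip f f - (ip f h)\<^sup>2 / ip h h"
      using pos by (simp add: c_def field_simps power2_eq_square)
    finally show ?thesis using pos by (simp add: field_simps)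
  qed
  then have "sqrt ((ip f h)\<^sup>2) \<le> sqrt (ip f f * ip h h)" by (rule real_sqrt_le_mono)
  then show ?thesis by (simp add: ip_norm_def real_sqrt_mult)
qed

text \<open>After squaring, this is Cauchy-Schwarz for the cross term.\<close>

lemma ip_norm_diff_le:
  assumes f: "f \<in> H" and h: "h \<in> H"
  shows "\<bar>ip_norm ip f - ip_norm ip h\<bar> \<le> ip_norm ip (\<lambda>x. f x - h x)"
proof -
  have "(ip_norm ip f - ip_norm ip h)\<^sup>2 \<le> ip f f - 2 * ip f h + ip h h"
    using ip_Cauchy_Schwarz[OF f h]
    by (simp add: power2_diff ip_norm_power2[OF f] ip_norm_power2[OF h])
  also have "\<dots> = (ip_norm ip (\<lambda>x. f x - h x))\<^sup>2"
    using ip_self_diff[OF f h] ip_norm_power2[OF diff_mem[OF f h]] by simp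
  finally show ?thesis
    using ip_norm_nonneg[OF diff_mem[OF f h]] by (metis abs_le_square_iff abs_of_nonneg)
qed

section \<open>Norm convergence and uniform limits\<close>

lemma tendsto_ip_norm:
  assumes "\<And>n. u n \<in> H" "l \<in> H" "(\<lambda>n. ip_norm ip (\<lambda>x. u n x - l x)) \<longlonglongrightarrow> 0"
  shows "(\<lambda>n. ip_norm ip (u n)) \<longlonglongrightarrow> ip_norm ip l"
proof -
  have "(\<lambda>n. ip_norm ip (u n) - ip_norm ip l) \<longlonglongrightarrow> 0"
    by (rule Lim_null_comparison[OF _ assms(3)]) (simp add: ip_norm_diff_le assms)
  then show ?thesis by (simp add: LIM_zero_iff)
qed

text \<open>Evaluation at \<open>x\<close> is the inner product with the kernel section at
  \<open>x\<close>, so Cauchy-Schwarz makes it continuous in norm.\<close>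

lemma tendsto_eval:
  assumes u: "\<And>n. u n \<in> H" and l: "l \<in> H"
    and lim: "(\<lambda>n. ip_norm ip (\<lambda>x. u n x - l x)) \<longlonglongrightarrow> 0" and x: "x \<in> X"
  shows "(\<lambda>n. u n x) \<longlonglongrightarrow> l x"
proof -
  define k where "k = (\<lambda>y. if y \<in> X then K x y else 0)"
  have k: "k \<in> H" unfolding k_def using x by (rule kernel_mem)
  have bound: "norm (u n x - l x) \<le> ip_norm ip (\<lambda>x. u n x - l x) * ip_norm ip k" for n
    using ip_Cauchy_Schwarz[OF diff_mem[OF u l] k, of n]
      reproducing[OF x diff_mem[OF u l], of n] by (simp add: k_def)
  have "(\<lambda>n. ip_norm ip (\<lambda>x. u n x - l x) * ip_norm ip k) \<longlonglongrightarrow> 0"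
    using lim by (rule tendsto_mult_left_zero)
  then have "(\<lambda>n. u n x - l x) \<longlonglongrightarrow> 0"
    by (rule Lim_null_comparison[OF always_eventually[OF allI[OF bound]]])
  then show ?thesis by (simp add: LIM_zero_iff)
qed

text \<open>In Hilbert space terms \<open>h\<close> is the weak limit of \<open>u\<close>: the bound
  by \<open>L\<close> is weak lower semicontinuity of the norm, and the last conclusion is the
  Radon-Riesz property.\<close>

lemma uniform_limit_mem:
  assumes u: "\<And>n. u n \<in> H"
    and unif: "uniform_limit X u v sequentially"
    and L: "(\<lambda>n. ip_norm ip (u n)) \<longlonglongrightarrow> L"
  obtains h where "h \<in> H" "\<And>x. x \<in> X \<Longrightarrow> h x = v x" "ip_norm ip h \<le> L"
    "ip_norm ip h = L \<Longrightarrow> (\<lambda>n. ip_norm ip (\<lambda>x. u n x - h x)) \<longlonglongrightarrow> 0"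
proof -
  \<comment> \<open>Positive radii put a tail of \<open>u\<close> into every \<open>C n\<close>;
    radii tending to 0 force a limit of elements \<open>f n\<close> of \<open>C n\<close> to equal
    \<open>v\<close> on \<open>X\<close>.\<close>
  define \<delta> where "\<delta> n = 1 / real (Suc n)" for n
  have \<delta>_pos: "\<delta> n > 0" for n by (simp add: \<delta>_def)
  have \<delta>_mono: "\<delta> n \<le> \<delta> k" if "k \<le> n" for n k using that by (simp add: \<delta>_def frac_le)
  have \<delta>_lim: "\<delta> \<longlonglongrightarrow> 0"
    using LIMSEQ_inverse_real_of_nat by (simp add: \<delta>_def[abs_def] inverse_eq_divide)
  define C where "C n = {f \<in> H. \<forall>x \<in> X. \<bar>f x - v x\<bar> \<le> \<delta> n}" for n
  define D where "D n = (INF f \<in> C n. ip f f)" for n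
  have L0: "L \<ge> 0"
    using L u by (intro LIMSEQ_le_const) (auto simp: ip_norm_nonneg)
  have L2: "(\<lambda>n. ip (u n) (u n)) \<longlonglongrightarrow> L\<^sup>2"
    using tendsto_power[OF L, of 2] by (simp add: ip_norm_power2 u)
  have CH: "f \<in> H" if "f \<in> C n" for f n using that by (simp add: C_def)
  have evC: "\<forall>\<^sub>F k in sequentially. u k \<in> C n" for n
    by (rule eventually_mono[OF uniform_limitD[OF unif \<delta>_pos[of n]]])
      (auto simp: C_def u dist_real_def intro: less_imp_le)
  have Cne: "C n \<noteq> {}" for n
    using eventually_happens'[OF sequentially_bot evC[of n]] by blast
  have bdd: "bdd_below ((\<lambda>f. ip f f) ` C n)" for n
    using CH ip_nonneg by (intro bdd_belowI[where m = 0]) blast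
  have D_le: "D n \<le> ip f f" if "f \<in> C n" for n f
    unfolding D_def using that by (intro cINF_lower bdd)
  have C_mono: "C n \<subseteq> C k" if "k \<le> n" for n k
    unfolding C_def using \<delta>_mono[OF that] order_trans by blast
  have "incseq D"
  proof (rule incseq_SucI)
    show "D n \<le> D (Suc n)" for n
      unfolding D_def using C_mono by (intro cINF_superset_mono Cne bdd) auto
  qed
  \<comment> \<open>The infimum over \<open>C n\<close> is at most the squared norm of all but
    finitely many \<open>u k\<close>, hence at most the limit of these.\<close>
  moreover have DL: "D n \<le> L\<^sup>2" for n
    by (rule tendsto_lowerbound[OF L2 eventually_mono[OF evC[of n] D_le]]) simp_all
  ultimately obtain d where d: "D \<longlonglongrightarrow> d" "\<And>n. D n \<le> d"
    using incseq_convergent by blast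
  have dL: "d \<le> L\<^sup>2" using d(1) DL by (intro LIMSEQ_le_const2) auto
  have near: "ip (\<lambda>x. f x - k x) (\<lambda>x. f x - k x) \<le> 2 * ip f f + 2 * ip k k - 4 * D n"
    if f: "f \<in> C n" and k: "k \<in> C n" for f k n
  proof -
    \<comment> \<open>Convexity of \<open>C n\<close>, pointwise: averaging two values preserves the
      error bound.\<close>
    have "\<bar>1/2 * (a + b) - c\<bar> \<le> e" if "\<bar>a - c\<bar> \<le> e" "\<bar>b - c\<bar> \<le> e" for a b c e :: real
      using that by (simp add: abs_le_iff field_simps)
    then have "\<bar>1/2 * (f x + k x) - v x\<bar> \<le> \<delta> n" if "x \<in> X" for x
      using f k that unfolding C_def by blast
    then have "(\<lambda>x. 1/2 * (f x + k x)) \<in> C n"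
      using scale_mem[OF add_mem[OF CH[OF f] CH[OF k]], of "1/2"] by (simp add: C_def)
    from D_le[OF this] show ?thesis using ip_parallelogram[OF CH[OF f] CH[OF k]] by simp
  qed
  have "\<exists>f \<in> C n. ip f f < D n + \<delta> n" for n
    using cINF_less_iff[OF Cne bdd, of n "D n + \<delta> n"] \<delta>_pos[of n] by (simp add: D_def)
  then obtain f where f: "\<And>n. f n \<in> C n" "\<And>n. ip (f n) (f n) < D n + \<delta> n"
    by metis
  have fH: "f n \<in> H" for n using f(1) CH by blast
  have "\<exists>N. \<forall>m \<ge> N. \<forall>n \<ge> N. ip_norm ip (\<lambda>x. f m x - f n x) < e" if e: "e > 0" for e
  proof -
    \<comment> \<open>From index \<open>n\<close> on, the chosen elements lie in \<open>C n\<close>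
      and have squared norm at most \<open>d + \<delta> n\<close>, so \<open>near\<close> bounds
      their squared distances by this expression.\<close>
    have "(\<lambda>n. 4 * (d - D n) + 4 * \<delta> n) \<longlonglongrightarrow> 4 * (d - d) + 4 * 0"
      by (intro tendsto_intros d \<delta>_lim)
    then have "\<forall>\<^sub>F n in sequentially. 4 * (d - D n) + 4 * \<delta> n < e\<^sup>2"
      by (rule order_tendstoD) (use e in simp)
    then obtain N where N: "4 * (d - D N) + 4 * \<delta> N < e\<^sup>2"
      using eventually_happens'[OF sequentially_bot] by blast
    have fN: "f n \<in> C N" "ip (f n) (f n) \<le> d + \<delta> N" if "n \<ge> N" for n
    proof -
      show "f n \<in> C N" using C_mono[OF that] f(1) by blast
      show "ip (f n) (f n) \<le> d + \<delta> N" using \<delta>_mono[OF that] f(2)[of n] d(2)[of n] by linarith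
    qed
    have "ip_norm ip (\<lambda>x. f m x - f n x) < e" if mn: "m \<ge> N" "n \<ge> N" for m n
    proof -
      have "ip (\<lambda>x. f m x - f n x) (\<lambda>x. f m x - f n x) < e\<^sup>2"
        using near[OF fN(1)[OF mn(1)] fN(1)[OF mn(2)]] fN(2)[OF mn(1)] fN(2)[OF mn(2)] N
        by (smt (verit, best))
      then show ?thesis using e unfolding ip_norm_def by (simp add: real_less_lsqrt)
    qed
    then show ?thesis by blast
  qed
  then obtain h where h: "h \<in> H" and lim: "(\<lambda>n. ip_norm ip (\<lambda>x. f n x - h x)) \<longlonglongrightarrow> 0"
    using complete[of f] fH by blast
  have hv: "h x = v x" if x: "x \<in> X" for x
  proof -
    have "(\<lambda>n. f n x - v x) \<longlonglongrightarrow> 0"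
      by (rule Lim_null_comparison[OF _ \<delta>_lim]) (use f(1) x in \<open>auto simp: C_def\<close>)
    then have "(\<lambda>n. f n x) \<longlonglongrightarrow> v x" by (simp add: LIM_zero_iff)
    then show ?thesis using tendsto_eval[OF fH h lim x] LIMSEQ_unique by blast
  qed
  \<comment> \<open>Membership in every \<open>C n\<close> allows comparing \<open>h\<close> with
    \<open>u k\<close> through \<open>near\<close>.\<close>
  have hC: "h \<in> C n" for n using h hv \<delta>_pos by (simp add: C_def less_imp_le)
  have "(\<lambda>n. ip (f n) (f n)) \<longlonglongrightarrow> ip h h"
    using tendsto_power[OF tendsto_ip_norm[OF fH h lim], of 2] by (simp add: ip_norm_power2 fH h)
  moreover have "(\<lambda>n. ip (f n) (f n)) \<longlonglongrightarrow> d"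
  proof (rule tendsto_sandwich[OF _ _ d(1)])
    show "(\<lambda>n. D n + \<delta> n) \<longlonglongrightarrow> d" using tendsto_add[OF d(1) \<delta>_lim] by simp
    show "\<forall>\<^sub>F n in sequentially. D n \<le> ip (f n) (f n)"
      by (intro always_eventually allI D_le f(1))
    show "\<forall>\<^sub>F n in sequentially. ip (f n) (f n) \<le> D n + \<delta> n"
      by (intro always_eventually allI less_imp_le f(2))
  qed
  ultimately have hd: "ip h h = d" using LIMSEQ_unique by blast
  have le: "ip_norm ip h \<le> L"
    using dL hd L0 by (simp add: ip_norm_def real_le_lsqrt)
  have strong: "(\<lambda>n. ip_norm ip (\<lambda>x. u n x - h x)) \<longlonglongrightarrow> 0" if "ip_norm ip h = L"
  proof -
    have Ld: "L\<^sup>2 = d" using that hd ip_norm_power2[OF h] by simp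
    have "(\<lambda>k. ip (\<lambda>x. u k x - h x) (\<lambda>x. u k x - h x)) \<longlonglongrightarrow> 0"
    proof (rule order_tendstoI)
      fix a :: real assume "a < 0"
      then show "\<forall>\<^sub>F k in sequentially. a < ip (\<lambda>x. u k x - h x) (\<lambda>x. u k x - h x)"
        by (intro always_eventually allI order.strict_trans2[OF _ ip_nonneg[OF diff_mem[OF u h]]])
    next
      fix a :: real assume a: "0 < a"
      \<comment> \<open>First \<open>n\<close> is fixed so that \<open>4 * (d - D n)\<close> is
        small. Only then does \<open>k\<close> grow: the bound from \<open>near\<close> tends to
        exactly this value, because \<open>L\<^sup>2 = ip h h = d\<close>.\<close>
      have "(\<lambda>n. 4 * (d - D n)) \<longlonglongrightarrow> 4 * (d - d)" by (intro tendsto_intros d)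
      then have "\<forall>\<^sub>F n in sequentially. 4 * (d - D n) < a"
        by (rule order_tendstoD) (use a in simp)
      then obtain n where n: "4 * (d - D n) < a"
        using eventually_happens'[OF sequentially_bot] by blast
      have "(\<lambda>k. 2 * ip (u k) (u k) + 2 * ip h h - 4 * D n) \<longlonglongrightarrow> 2 * L\<^sup>2 + 2 * ip h h - 4 * D n"
        by (intro tendsto_intros L2)
      then have "\<forall>\<^sub>F k in sequentially. 2 * ip (u k) (u k) + 2 * ip h h - 4 * D n < a"
        by (rule order_tendstoD) (use n hd Ld in simp)
      with evC[of n] show "\<forall>\<^sub>F k in sequentially. ip (\<lambda>x. u k x - h x) (\<lambda>x. u k x - h x) < a"
      proof eventually_elim
        case (elim k)
        then show ?case using near[OF elim(1) hC] by linarith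
      qed
    qed
    from tendsto_real_sqrt[OF this] show ?thesis by (simp add: ip_norm_def)
  qed
  show thesis by (rule that[of h]) (fact h hv le strong)+
qed

end


section \<open>Sobolev norms\<close>

text \<open>The three summands under the root are nonnegative for every \<open>u\<close>, since a
  Bochner integral of a non-integrable function is 0.\<close>

lemma sobolev_norm_ge_L2: "(LINT x|lebesgue_on \<Omega>. (u x)\<^sup>2) \<le> (sobolev_norm t \<Omega> u)\<^sup>2"
  and sobolev_norm_nonneg: "0 \<le> sobolev_norm t \<Omega> u"
proof -
  have G: "0 \<le> gagliardo_integrand \<sigma> w z" for \<sigma> and w :: "real^'n \<Rightarrow> real" and z
    by (cases z) (simp add: gagliardo_integrand_def)
  let ?a = "LINT x|lebesgue_on \<Omega>. (u x)\<^sup>2"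
  let ?b = "\<Sum>\<alpha> | 1 \<le> length \<alpha> \<and> length \<alpha> \<le> nat \<lfloor>t\<rfloor>.
        LINT x|lebesgue_on \<Omega>. (weak_partial \<Omega> \<alpha> u x)\<^sup>2"
  let ?c = "if frac t > 0
      then (\<Sum>\<alpha> | length \<alpha> = nat \<lfloor>t\<rfloor>. LINT z|(lebesgue_on \<Omega> \<Otimes>\<^sub>M lebesgue_on \<Omega>).
              gagliardo_integrand (frac t) (weak_partial \<Omega> \<alpha> u) z)
      else 0"
  have nn: "0 \<le> ?a" "0 \<le> ?b" "0 \<le> ?c"
    by (auto intro!: sum_nonneg Bochner_Integration.integral_nonneg G)
  have eq: "sobolev_norm t \<Omega> u = sqrt (?a + ?b + ?c)" by (rule sobolev_norm_def)
  have "0 \<le> ?a + ?b + ?c" using nn by (intro add_nonneg_nonneg)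
  then show "0 \<le> sobolev_norm t \<Omega> u" unfolding eq by (rule real_sqrt_ge_zero)
  have "(sobolev_norm t \<Omega> u)\<^sup>2 = ?a + ?b + ?c"
    unfolding eq using \<open>0 \<le> ?a + ?b + ?c\<close> by (rule real_sqrt_pow2)
  then show "?a \<le> (sobolev_norm t \<Omega> u)\<^sup>2" using nn(2,3) by linarith
qed

lemma L2_diff:
  assumes "u \<in> L2 \<Omega>" "v \<in> L2 \<Omega>"
  shows "(\<lambda>x. u x - v x) \<in> L2 \<Omega>"
proof -
  have "integrable (lebesgue_on \<Omega>) (\<lambda>x. (u x - v x)\<^sup>2)"
  proof (rule Bochner_Integration.integrable_bound)
    show "integrable (lebesgue_on \<Omega>) (\<lambda>x. 2 * (u x)\<^sup>2 + 2 * (v x)\<^sup>2)"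
      using assms by (simp add: L2_def)
    show "AE x in lebesgue_on \<Omega>. norm ((u x - v x)\<^sup>2) \<le> norm (2 * (u x)\<^sup>2 + 2 * (v x)\<^sup>2)"
    proof (intro AE_I2)
      fix x
      have "(u x - v x)\<^sup>2 \<le> 2 * (u x)\<^sup>2 + 2 * (v x)\<^sup>2"
        using zero_le_power2[of "u x + v x"] by (simp add: power2_sum power2_diff)
      then show "norm ((u x - v x)\<^sup>2) \<le> norm (2 * (u x)\<^sup>2 + 2 * (v x)\<^sup>2)" by simp
    qed
  qed (use assms in \<open>auto simp: L2_def\<close>)
  then show ?thesis using assms by (auto simp: L2_def)
qed

text \<open>Apart from membership in \<open>L2\<close>, the function enters only through integrals
  against derivatives of test functions, and these ignore null sets.\<close>

lemma has_weak_partial_cong_AE: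
  assumes \<Omega>: "open \<Omega>" and uv: "u \<in> L2 \<Omega>" "v \<in> L2 \<Omega>" "AE x in lebesgue_on \<Omega>. u x = v x"
  shows "has_weak_partial \<Omega> \<alpha> u w \<longleftrightarrow> has_weak_partial \<Omega> \<alpha> v w"
proof -
  have "(LINT x|lebesgue_on \<Omega>. u x * partials \<alpha> \<phi> x) =
      (LINT x|lebesgue_on \<Omega>. v x * partials \<alpha> \<phi> x)"
    if "\<phi> \<in> test_functions \<Omega>" for \<phi>
  proof (rule integral_cong_AE)
    have "partials \<alpha> \<phi> differentiable (at x)" for x
      using that by (simp add: test_functions_def smooth_def)
    then have "continuous_on \<Omega> (partials \<alpha> \<phi>)"
      by (intro continuous_at_imp_continuous_on ballI differentiable_imp_continuous_within)
    then have "partials \<alpha> \<phi> \<in> borel_measurable (lebesgue_on \<Omega>)"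
      using \<Omega> by (intro continuous_imp_measurable_on_sets_lebesgue) auto
    then show "(\<lambda>x. u x * partials \<alpha> \<phi> x) \<in> borel_measurable (lebesgue_on \<Omega>)"
      "(\<lambda>x. v x * partials \<alpha> \<phi> x) \<in> borel_measurable (lebesgue_on \<Omega>)"
      using uv by (auto simp: L2_def)
  qed (use uv(3) in \<open>auto elim: eventually_mono\<close>)
  then show ?thesis using uv by (simp add: has_weak_partial_def)
qed

text \<open>Uniqueness of weak derivatives is not needed here: the predicates from which \<open>SOME\<close> chooses
  the two derivatives coincide, hence so do the choices.\<close>

lemma sobolev_norm_cong_AE:
  assumes \<Omega>: "open \<Omega>" and uv: "u \<in> L2 \<Omega>" "v \<in> L2 \<Omega>" "AE x in lebesgue_on \<Omega>. u x = v x"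
  shows "sobolev_norm t \<Omega> u = sobolev_norm t \<Omega> v"
proof -
  have "weak_partial \<Omega> \<alpha> u = weak_partial \<Omega> \<alpha> v" for \<alpha>
    unfolding weak_partial_def using has_weak_partial_cong_AE[OF assms] by presburger
  moreover have "(LINT x|lebesgue_on \<Omega>. (u x)\<^sup>2) = (LINT x|lebesgue_on \<Omega>. (v x)\<^sup>2)"
    by (rule integral_cong_AE) (use assms in \<open>auto simp: L2_def elim: eventually_mono\<close>)
  ultimately show ?thesis by (simp add: sobolev_norm_def)
qed

text \<open>On a set of finite measure, uniform convergence implies convergence in mean square, and
  so does Sobolev convergence. Hence \<open>h\<close> and \<open>w\<close> agree almost everywhere,
  and exchanging them does not change the Sobolev norms of the differences.\<close>

lemma sobolev_uniform_limit:
  assumes \<Omega>: "open \<Omega>" "bounded \<Omega>"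
    and u: "\<And>n. u n \<in> L2 \<Omega>" and h: "h \<in> L2 \<Omega>" and w: "w \<in> L2 \<Omega>"
    and unif: "uniform_limit \<Omega> u h sequentially"
    and lim: "(\<lambda>n. sobolev_norm t \<Omega> (\<lambda>x. u n x - w x)) \<longlonglongrightarrow> 0"
  shows "(\<lambda>n. sobolev_norm t \<Omega> (\<lambda>x. u n x - h x)) \<longlonglongrightarrow> 0"
proof -
  let ?M = "lebesgue_on \<Omega>"
  have meas: "\<Omega> \<in> lmeasurable"
    using \<Omega> lmeasurable_open by blast
  interpret finite_measure ?M
    using meas by (rule finite_measure_lebesgue_on)
  define I where "I = (LINT x|?M. (h x - w x)\<^sup>2)"
  define c where "c = measure ?M (space ?M)"
  have int: "integrable ?M (\<lambda>x. (a x - b x)\<^sup>2)" if "a \<in> L2 \<Omega>" "b \<in> L2 \<Omega>" for a b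
    using L2_diff[OF that] by (simp add: L2_def)
  have bound: "I \<le> 2 * (e * c) + 2 * (sobolev_norm t \<Omega> (\<lambda>x. u n x - w x))\<^sup>2"
    if n: "\<forall>x \<in> \<Omega>. dist (u n x) (h x) < sqrt e" and e: "e > 0" for e n
  proof -
    have *: "(h x - w x)\<^sup>2 \<le> 2 * e + 2 * (u n x - w x)\<^sup>2" if "x \<in> space ?M" for x
    proof -
      have "\<bar>u n x - h x\<bar> \<le> sqrt e"
        using n that by (auto simp: dist_real_def intro: less_imp_le)
      then have "(u n x - h x)\<^sup>2 \<le> e" using e by (simp add: sqrt_ge_absD)
      \<comment> \<open>Right side minus left side is
        \<open>(2 * u n x - h x - w x)\<^sup>2\<close>.\<close>
      moreover have "(h x - w x)\<^sup>2 \<le> 2 * (u n x - h x)\<^sup>2 + 2 * (u n x - w x)\<^sup>2"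
        using zero_le_power2[of "2 * u n x - h x - w x"]
        by (simp add: power2_eq_square algebra_simps)
      ultimately show ?thesis by linarith
    qed
    have "I \<le> (LINT x|?M. 2 * e + 2 * (u n x - w x)\<^sup>2)"
      unfolding I_def using * int[OF h w] int[OF u w] by (intro integral_mono) auto
    also have "\<dots> = 2 * (e * c) + 2 * (LINT x|?M. (u n x - w x)\<^sup>2)"
      using int[OF u w] by (simp add: c_def)
    also have "\<dots> \<le> 2 * (e * c) + 2 * (sobolev_norm t \<Omega> (\<lambda>x. u n x - w x))\<^sup>2"
      using sobolev_norm_ge_L2[of \<Omega> "\<lambda>x. u n x - w x" t] by simp
    finally show ?thesis .
  qed
  \<comment> \<open>Two limits in turn: \<open>n\<close> to infinity for fixed \<open>e\<close>,
    then \<open>e\<close> to 0 from the right.\<close>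
  have "I \<le> 2 * (e * c)" if e: "e > 0" for e
  proof (rule tendsto_lowerbound)
    show "(\<lambda>n. 2 * (e * c) + 2 * (sobolev_norm t \<Omega> (\<lambda>x. u n x - w x))\<^sup>2) \<longlonglongrightarrow> 2 * (e * c)"
      using tendsto_add[OF tendsto_const tendsto_mult[OF tendsto_const tendsto_power[OF lim, of 2]],
          of "2 * (e * c)" 2] by simp
    show "\<forall>\<^sub>F n in sequentially. I \<le> 2 * (e * c) + 2 * (sobolev_norm t \<Omega> (\<lambda>x. u n x - w x))\<^sup>2"
      using uniform_limitD[OF unif, of "sqrt e"] e bound by (auto elim: eventually_mono)
  qed simp
  moreover have "((\<lambda>e. 2 * (e * c)) \<longlongrightarrow> 2 * (0 * c)) (at_right 0)"
    by (intro tendsto_intros)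
  ultimately have "I \<le> 2 * (0 * c)"
    by (intro tendsto_lowerbound[where F = "at_right (0::real)"])
      (auto simp: eventually_at_filter)
  moreover have "I \<ge> 0" unfolding I_def by simp
  ultimately have "I = 0" by simp
  then have "AE x in ?M. (h x - w x)\<^sup>2 = 0"
    using integral_nonneg_eq_0_iff_AE[OF int[OF h w]] by (simp add: I_def)
  then have "AE x in ?M. u n x - w x = u n x - h x" for n by (auto elim: eventually_mono)
  then have "sobolev_norm t \<Omega> (\<lambda>x. u n x - w x) = sobolev_norm t \<Omega> (\<lambda>x. u n x - h x)" for n
    using u h w \<Omega>(1) by (intro sobolev_norm_cong_AE L2_diff)
  then show ?thesis using lim by simp
qed


section \<open>Dual norms\<close>

lemma sobolev_dual_bound:
  assumes "l \<in> sobolev_dual s \<Omega>"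
  obtains C where "\<And>v. v \<in> sobolev_space_0 s \<Omega> \<Longrightarrow> \<bar>l v\<bar> \<le> C * sobolev_norm s \<Omega> v"
  using assms unfolding sobolev_dual_def by blast

text \<open>A real supremum dominates its members only when they are bounded above; this makes the
  one in \<open>sobolev_dual_norm\<close> usable.\<close>

lemma sobolev_dual_bdd:
  assumes "l \<in> sobolev_dual s \<Omega>"
  shows "bdd_above ((\<lambda>v. \<bar>l v\<bar>) ` {v \<in> sobolev_space_0 s \<Omega>. sobolev_norm s \<Omega> v \<le> 1})"
proof -
  obtain C where C: "\<And>v. v \<in> sobolev_space_0 s \<Omega> \<Longrightarrow> \<bar>l v\<bar> \<le> C * sobolev_norm s \<Omega> v"
    using sobolev_dual_bound[OF assms] by blast
  have "\<bar>l v\<bar> \<le> \<bar>C\<bar>" if "v \<in> sobolev_space_0 s \<Omega>" "sobolev_norm s \<Omega> v \<le> 1" for v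
  proof -
    \<comment> \<open>The constant in \<open>sobolev_dual\<close> may be negative, hence the
      absolute value.\<close>
    have "C * sobolev_norm s \<Omega> v \<le> \<bar>C\<bar> * 1"
      using that(2) sobolev_norm_nonneg by (intro mult_mono) auto
    then show ?thesis using C[OF that(1)] by simp
  qed
  then show ?thesis by (intro bdd_aboveI[where M = "\<bar>C\<bar>"]) auto
qed

text \<open>The maximum with \<open>0\<close> covers the case of an empty \<open>S\<close>, where the suprema have a common but
  unspecified value; this saves proving that the unit ball of the Sobolev space is nonempty.\<close>

lemma SUP_abs_diff_le:
  fixes a b :: "'a \<Rightarrow> real"
  assumes a: "bdd_above ((\<lambda>v. \<bar>a v\<bar>) ` S)" and b: "bdd_above ((\<lambda>v. \<bar>b v\<bar>) ` S)"
  shows "\<bar>(SUP v \<in> S. \<bar>a v\<bar>) - (SUP v \<in> S. \<bar>b v\<bar>)\<bar> \<le> max 0 (SUP v \<in> S. \<bar>a v - b v\<bar>)"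
proof (cases "S = {}")
  case False
  obtain A B where AB: "\<And>v. v \<in> S \<Longrightarrow> \<bar>a v\<bar> \<le> A" "\<And>v. v \<in> S \<Longrightarrow> \<bar>b v\<bar> \<le> B"
    using a b by (auto simp: bdd_above_def)
  have ab: "bdd_above ((\<lambda>v. \<bar>a v - b v\<bar>) ` S)"
    by (rule bdd_aboveI[where M = "A + B"]) (use AB in fastforce)
  have "\<bar>a v\<bar> \<le> (SUP v \<in> S. \<bar>b v\<bar>) + (SUP v \<in> S. \<bar>a v - b v\<bar>)"
    and "\<bar>b v\<bar> \<le> (SUP v \<in> S. \<bar>a v\<bar>) + (SUP v \<in> S. \<bar>a v - b v\<bar>)" if "v \<in> S" for v
    using cSUP_upper[OF that a] cSUP_upper[OF that b] cSUP_upper[OF that ab] by linarith+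
  then have "(SUP v \<in> S. \<bar>a v\<bar>) \<le> (SUP v \<in> S. \<bar>b v\<bar>) + (SUP v \<in> S. \<bar>a v - b v\<bar>)"
    and "(SUP v \<in> S. \<bar>b v\<bar>) \<le> (SUP v \<in> S. \<bar>a v\<bar>) + (SUP v \<in> S. \<bar>a v - b v\<bar>)"
    using False by (auto intro!: cSUP_least)
  then show ?thesis by linarith
qed simp

lemma sobolev_dual_diff:
  assumes "l \<in> sobolev_dual s \<Omega>" "k \<in> sobolev_dual s \<Omega>"
  shows "(\<lambda>v. l v - k v) \<in> sobolev_dual s \<Omega>"
proof -
  obtain C D where CD: "\<And>v. v \<in> sobolev_space_0 s \<Omega> \<Longrightarrow> \<bar>l v\<bar> \<le> C * sobolev_norm s \<Omega> v"
    "\<And>v. v \<in> sobolev_space_0 s \<Omega> \<Longrightarrow> \<bar>k v\<bar> \<le> D * sobolev_norm s \<Omega> v"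
    using sobolev_dual_bound[OF assms(1)] sobolev_dual_bound[OF assms(2)] by metis
  have "\<bar>l v - k v\<bar> \<le> (C + D) * sobolev_norm s \<Omega> v" if "v \<in> sobolev_space_0 s \<Omega>" for v
    using CD[OF that] by (simp add: distrib_right)
  then have "\<exists>C. \<forall>v \<in> sobolev_space_0 s \<Omega>. \<bar>l v - k v\<bar> \<le> C * sobolev_norm s \<Omega> v" by blast
  then show ?thesis using assms by (simp add: sobolev_dual_def algebra_simps)
qed

text \<open>The shift by \<open>\<xi>\<close> cancels in the difference, leaving the reverse
  triangle inequality. It carries continuity of an operator over to the norm of its
  residual.\<close>

lemma sobolev_dual_norm_diff_le:
  assumes "l \<in> sobolev_dual s \<Omega>" "k \<in> sobolev_dual s \<Omega>" "\<xi> \<in> sobolev_dual s \<Omega>"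
  shows "\<bar>sobolev_dual_norm s \<Omega> (\<lambda>v. l v - \<xi> v) - sobolev_dual_norm s \<Omega> (\<lambda>v. k v - \<xi> v)\<bar>
    \<le> max 0 (sobolev_dual_norm s \<Omega> (\<lambda>v. l v - k v))"
  using SUP_abs_diff_le[OF sobolev_dual_bdd[OF sobolev_dual_diff[OF assms(1,3)]]
      sobolev_dual_bdd[OF sobolev_dual_diff[OF assms(2,3)]]]
  by (simp add: sobolev_dual_norm_def)


section \<open>Minimizers\<close>

text \<open>Compactness and continuity keep the differences bounded, so the real supremum dominates
  each pointwise difference.\<close>

lemma uniform_limit_sup_norm:
  assumes X: "compact X" and u: "\<And>n. continuous_on X (u n)" and v: "continuous_on X v"
    and lim: "(\<lambda>n. sup_norm X (\<lambda>x. u n x - v x)) \<longlonglongrightarrow> 0"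
  shows "uniform_limit X u v sequentially"
proof (rule uniform_limitI)
  fix e :: real assume "e > 0"
  then have ev: "\<forall>\<^sub>F n in sequentially. sup_norm X (\<lambda>x. u n x - v x) < e"
    using lim by (intro order_tendstoD)
  have "dist (u n x) (v x) \<le> sup_norm X (\<lambda>x. u n x - v x)" if "x \<in> X" for n x
  proof -
    have "compact ((\<lambda>x. \<bar>u n x - v x\<bar>) ` X)"
      using X u v by (intro compact_continuous_image continuous_intros) auto
    then have "bdd_above ((\<lambda>x. \<bar>u n x - v x\<bar>) ` X)"
      by (intro bounded_imp_bdd_above compact_imp_bounded)
    then show ?thesis using that unfolding sup_norm_def dist_real_def by (intro cSUP_upper)
  qed
  then show "\<forall>\<^sub>F n in sequentially. \<forall>x \<in> X. dist (u n x) (v x) < e"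
    using ev by (auto elim!: eventually_mono intro: order.strict_trans1)
qed

theorem theorem2p2:
  fixes \<Omega> :: "(real^'n) set" and s t \<gamma> :: real
    and g :: "real^'n \<Rightarrow> real"
    and K :: "real^'n \<Rightarrow> real^'n \<Rightarrow> real"
    and H :: "(real^'n \<Rightarrow> real) set"
    and ip :: "(real^'n \<Rightarrow> real) \<Rightarrow> (real^'n \<Rightarrow> real) \<Rightarrow> real"
    and P :: "(real^'n \<Rightarrow> real) \<Rightarrow> (real^'n \<Rightarrow> real) \<Rightarrow> real"
    and \<xi> :: "(real^'n \<Rightarrow> real) \<Rightarrow> real"
    and J :: "(real^'n \<Rightarrow> real) \<Rightarrow> real"
    and A :: "(real^'n \<Rightarrow> real) set"
    and m :: ereal
  assumes domain: "bounded_lipschitz_domain \<Omega>"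
    and s: "s > 0"
    and t: "t > 1/2" "t > real CARD('n) / 2"
    and g: "continuous_on (frontier \<Omega>) g" "g \<in> boundary_trace_space t \<Omega>"
    and rkhs: "rkhs (closure \<Omega>) K H ip"
    and feasible: "\<exists>u \<in> H. \<forall>x \<in> frontier \<Omega>. u x = g x"
    and P_maps: "\<And>u. u \<in> sobolev_space_bc t \<Omega> g \<Longrightarrow> P u \<in> sobolev_dual s \<Omega>"
    and P_cont: "norm_continuous_on (sobolev_norm t \<Omega>) (sobolev_dual_norm s \<Omega>)
                   (sobolev_space_bc t \<Omega> g) P"
    and \<xi>: "\<xi> \<in> sobolev_dual s \<Omega>"
    and compact_C: "compact_embedding H (ip_norm ip)
                      (continuous_functions (closure \<Omega>)) (sup_norm (closure \<Omega>))"
    and compact_Ht: "compact_embedding H (ip_norm ip) (sobolev_space t \<Omega>) (sobolev_norm t \<Omega>)"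
    and \<gamma>: "\<gamma> > 0"
    and J_def: "J = (\<lambda>u. (sobolev_dual_norm s \<Omega> (\<lambda>v. P u v - \<xi> v))\<^sup>2 + \<gamma> * (ip_norm ip u)\<^sup>2)"
    and A_def: "A = {u \<in> H. \<forall>x \<in> frontier \<Omega>. u x = g x}"
    and m_def: "m = (INF u \<in> A. ereal (J u))"
  shows "0 \<le> m \<and> m < \<infinity> \<and>
    (\<exists>ustar \<in> A. m = ereal (J ustar)) \<and>
    (\<forall>u :: nat \<Rightarrow> real^'n \<Rightarrow> real. (\<forall>n. u n \<in> A) \<and> (\<lambda>n. ereal (J (u n))) \<longlonglongrightarrow> m \<longrightarrow>
       (\<exists>r :: nat \<Rightarrow> nat. \<exists>w \<in> A. strict_mono r \<and>
          (\<lambda>n. ip_norm ip (\<lambda>x. u (r n) x - w x)) \<longlonglongrightarrow> 0 \<and> m = ereal (J w))) \<and>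
    (\<forall>ustar \<in> A. m = ereal (J ustar) \<and> (\<forall>w \<in> A. m = ereal (J w) \<longrightarrow> w = ustar) \<longrightarrow>
       (\<forall>u :: nat \<Rightarrow> real^'n \<Rightarrow> real. (\<forall>n. u n \<in> A) \<and> (\<lambda>n. ereal (J (u n))) \<longlonglongrightarrow> m \<longrightarrow>
          (\<lambda>n. ip_norm ip (\<lambda>x. u n x - ustar x)) \<longlonglongrightarrow> 0))"
proof -
  interpret rkhs "closure \<Omega>" K H ip by (rule rkhs)
  have \<Omega>: "open \<Omega>" "bounded \<Omega>" using domain by (auto simp: bounded_lipschitz_domain_def)
  have comp: "compact (closure \<Omega>)" using \<Omega>(2) by (simp add: compact_closure)
  have H_cont: "continuous_on (closure \<Omega>) f" if "f \<in> H" for f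
    using compact_C that by (auto simp: compact_embedding_def continuous_functions_def)
  have H_sob: "f \<in> sobolev_space t \<Omega>" if "f \<in> H" for f
    using compact_Ht that by (auto simp: compact_embedding_def)
  have sob_L2: "f \<in> L2 \<Omega>" if "f \<in> sobolev_space t \<Omega>" for f
    using that by (simp add: sobolev_space_def)
  have AH: "f \<in> H" if "f \<in> A" for f using that by (simp add: A_def)
  \<comment> \<open>An element of \<open>H\<close> is continuous on the closure and serves as its
    own continuous representative in \<open>has_trace\<close>.\<close>
  have A_bc: "f \<in> sobolev_space_bc t \<Omega> g" if "f \<in> A" for f
    using that H_cont H_sob by (auto simp: A_def sobolev_space_bc_def has_trace_def)
  have A_ne: "A \<noteq> {}" using feasible by (auto simp: A_def)
  define R where "R f = sobolev_dual_norm s \<Omega> (\<lambda>v. P f v - \<xi> v)" for f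
  have J: "J f = (R f)\<^sup>2 + \<gamma> * (ip_norm ip f)\<^sup>2" for f by (simp add: J_def R_def)
  have J0: "J f \<ge> 0" for f using \<gamma> by (simp add: J)
  define \<mu> where "\<mu> = (INF f \<in> A. J f)"
  have bdd: "bdd_below (J ` A)" using J0 by (intro bdd_belowI[where m = 0]) auto
  have \<mu>_le: "\<mu> \<le> J f" if "f \<in> A" for f unfolding \<mu>_def using bdd that by (rule cINF_lower)
  \<comment> \<open>\<open>A\<close> is nonempty and \<open>J\<close> is nonnegative, so the
    extended infimum is a real number, and the argument continues with reals.\<close>
  have m: "m = ereal \<mu>"
    unfolding m_def \<mu>_def
    using ereal_Inf'[OF bdd] A_ne by (simp add: image_image)
  have \<mu>0: "\<mu> \<ge> 0" unfolding \<mu>_def using A_ne J0 by (intro cINF_greatest)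

  \<comment> \<open>The sequence and its limit must both satisfy the boundary condition, since
    \<open>P_cont\<close> speaks only of such functions.\<close>
  have R_lim: "(\<lambda>n. R (v n)) \<longlonglongrightarrow> R h"
    if v: "\<And>n. v n \<in> A" and h: "h \<in> A"
      and lim: "(\<lambda>n. sobolev_norm t \<Omega> (\<lambda>x. v n x - h x)) \<longlonglongrightarrow> 0" for v h
  proof (rule tendstoI)
    fix e :: real assume e: "e > 0"
    then obtain \<delta> where \<delta>: "\<delta> > 0" "\<And>f. f \<in> A \<Longrightarrow> sobolev_norm t \<Omega> (\<lambda>x. f x - h x) < \<delta> \<Longrightarrow>
        sobolev_dual_norm s \<Omega> (\<lambda>y. P f y - P h y) < e"
      using P_cont A_bc h unfolding norm_continuous_on_def by meson
    have "\<forall>\<^sub>F n in sequentially. sobolev_norm t \<Omega> (\<lambda>x. v n x - h x) < \<delta>"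
      using lim \<delta>(1) by (intro order_tendstoD)
    then show "\<forall>\<^sub>F n in sequentially. dist (R (v n)) (R h) < e"
    proof eventually_elim
      case (elim n)
      then show ?case
        using \<delta>(2)[OF v elim] e
          sobolev_dual_norm_diff_le[OF P_maps[OF A_bc[OF v]] P_maps[OF A_bc[OF h]] \<xi>, of n]
        by (simp add: dist_real_def R_def)
    qed
  qed

  have key: "\<exists>r :: nat \<Rightarrow> nat. \<exists>w \<in> A. strict_mono r \<and>
      (\<lambda>n. ip_norm ip (\<lambda>x. u (r n) x - w x)) \<longlonglongrightarrow> 0 \<and> m = ereal (J w)"
    if u: "\<And>n. u n \<in> A" and lim: "(\<lambda>n. ereal (J (u n))) \<longlonglongrightarrow> m" for u
  proof -
    have J_lim: "(\<lambda>n. J (u n)) \<longlonglongrightarrow> \<mu>" using lim m by simp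
    then obtain B where B: "\<And>n. \<bar>J (u n)\<bar> \<le> B"
      using convergent_imp_Bseq[of "\<lambda>n. J (u n)"] by (auto simp: convergent_def Bseq_def)
    \<comment> \<open>The residual is dropped; the penalty term alone controls the norm, as
      \<open>\<gamma>\<close> is positive.\<close>
    have "(ip_norm ip (u n))\<^sup>2 \<le> B / \<gamma>" for n
    proof -
      have "\<gamma> * (ip_norm ip (u n))\<^sup>2 \<le> B"
        using B[of n] J[of "u n"] zero_le_power2[of "R (u n)"] by linarith
      then show ?thesis using \<gamma> by (simp add: field_simps)
    qed
    then have norm_le: "\<bar>ip_norm ip (u n)\<bar> \<le> sqrt (B / \<gamma>)" for n by (metis real_le_rsqrt power2_abs)
    have bounded_sub: "bounded (range (\<lambda>n. ip_norm ip (u (r n))))" for r :: "nat \<Rightarrow> nat"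
      unfolding bounded_iff using norm_le by auto
    \<comment> \<open>Three successive extractions give a uniform limit \<open>v\<close>, a Sobolev
      limit \<open>w\<close> and a limit \<open>L\<close> of the norms. These are unrelated at
      first; \<open>uniform_limit_mem\<close> and \<open>sobolev_uniform_limit\<close> then replace
      both \<open>v\<close> and \<open>w\<close> by one \<open>h\<close> in
      \<open>H\<close>.\<close>
    obtain r1 v where r1: "strict_mono r1" and v: "continuous_on (closure \<Omega>) v"
      and lim1: "(\<lambda>n. sup_norm (closure \<Omega>) (\<lambda>x. u (r1 n) x - v x)) \<longlonglongrightarrow> 0"
      using compact_C AH[OF u] bounded_sub[of "\<lambda>n. n"]
      unfolding compact_embedding_def continuous_functions_def by blast
    obtain r2 w where r2: "strict_mono r2" and w: "w \<in> sobolev_space t \<Omega>"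
      and lim2: "(\<lambda>n. sobolev_norm t \<Omega> (\<lambda>x. u (r1 (r2 n)) x - w x)) \<longlonglongrightarrow> 0"
      using compact_Ht AH[OF u] bounded_sub[of r1]
      unfolding compact_embedding_def
      by (elim conjE allE[where x = "\<lambda>n. u (r1 n)"]) auto
    obtain L r3 where r3: "strict_mono r3"
      and lim3: "(\<lambda>n. ip_norm ip (u (r1 (r2 (r3 n))))) \<longlonglongrightarrow> L"
      using bounded_imp_convergent_subsequence[OF bounded_sub[of "\<lambda>n. r1 (r2 n)"]]
      by (auto simp: o_def)
    define r where "r n = r1 (r2 (r3 n))" for n
    have r: "strict_mono r" using r1 r2 r3 by (simp add: r_def strict_mono_def)
    have unif1: "uniform_limit (closure \<Omega>) (\<lambda>n. u (r1 n)) v sequentially"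
      using comp v lim1 H_cont AH u by (intro uniform_limit_sup_norm) auto
    have unif: "uniform_limit (closure \<Omega>) (\<lambda>n. u (r n)) v sequentially"
      using filterlim_compose[OF unif1 filterlim_subseq[OF strict_mono_o[OF r2 r3]]]
      by (simp add: r_def o_def)
    have L: "(\<lambda>n. ip_norm ip (u (r n))) \<longlonglongrightarrow> L" using lim3 by (simp add: r_def)
    obtain h where h: "h \<in> H" and hv: "\<And>x. x \<in> closure \<Omega> \<Longrightarrow> h x = v x" and hL: "ip_norm ip h \<le> L"
      and strong: "ip_norm ip h = L \<Longrightarrow> (\<lambda>n. ip_norm ip (\<lambda>x. u (r n) x - h x)) \<longlonglongrightarrow> 0"
      using AH u by (auto intro: uniform_limit_mem[OF _ unif L])
    have "h x = g x" if "x \<in> frontier \<Omega>" for x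
    proof -
      have x: "x \<in> closure \<Omega>" using that by (simp add: frontier_def)
      have "(\<lambda>n. u (r n) x) \<longlonglongrightarrow> v x" using unif x by (rule tendsto_uniform_limitI)
      moreover have "u (r n) x = g x" for n using u that by (simp add: A_def)
      ultimately show ?thesis using hv[OF x] by (simp add: LIMSEQ_const_iff)
    qed
    then have hA: "h \<in> A" using h by (simp add: A_def)
    have "uniform_limit \<Omega> (\<lambda>n. u (r n)) v sequentially"
      using unif closure_subset by (rule uniform_limit_on_subset)
    then have unif': "uniform_limit \<Omega> (\<lambda>n. u (r n)) h sequentially"
      using hv closure_subset by (subst uniform_limit_cong'[where g = "\<lambda>n. u (r n)" and i = v]) auto
    have lim_w: "(\<lambda>n. sobolev_norm t \<Omega> (\<lambda>x. u (r n) x - w x)) \<longlonglongrightarrow> 0"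
      using LIMSEQ_subseq_LIMSEQ[OF lim2 r3] by (simp add: r_def o_def)
    have "u (r n) \<in> L2 \<Omega>" for n using u AH H_sob sob_L2 by blast
    then have "(\<lambda>n. sobolev_norm t \<Omega> (\<lambda>x. u (r n) x - h x)) \<longlonglongrightarrow> 0"
      by (rule sobolev_uniform_limit[OF \<Omega> _ sob_L2[OF H_sob[OF h]] sob_L2[OF w] unif' lim_w])
    then have "(\<lambda>n. R (u (r n))) \<longlonglongrightarrow> R h" by (intro R_lim u hA)
    \<comment> \<open>The limit of the penalty involves \<open>L\<close>, which is so far only an
      upper bound for the norm of \<open>h\<close>.\<close>
    then have "(\<lambda>n. J (u (r n))) \<longlonglongrightarrow> (R h)\<^sup>2 + \<gamma> * L\<^sup>2"
      unfolding J by (intro tendsto_intros L)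
    moreover have "(\<lambda>n. J (u (r n))) \<longlonglongrightarrow> \<mu>"
      using LIMSEQ_subseq_LIMSEQ[OF J_lim r] by (simp add: o_def)
    ultimately have \<mu>_eq: "\<mu> = (R h)\<^sup>2 + \<gamma> * L\<^sup>2" using LIMSEQ_unique by blast
    \<comment> \<open>Since \<open>\<mu> \<le> J h\<close>, the residual terms cancel and leave the
      inequality opposite to \<open>hL\<close>. Equality of the norms is what \<open>strong\<close>
      asks for.\<close>
    then have "L\<^sup>2 \<le> (ip_norm ip h)\<^sup>2" using \<mu>_le[OF hA] \<gamma> by (simp add: J)
    then have "L \<le> ip_norm ip h" using ip_norm_nonneg[OF h] by (rule power2_le_imp_le)
    with hL have eq: "ip_norm ip h = L" by simp
    then have "m = ereal (J h)" using m \<mu>_eq J by simp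
    then show ?thesis using r hA strong[OF eq] by blast
  qed

  \<comment> \<open>Existence follows from compactness: some minimizing sequence exists, and
    \<open>key\<close> turns it into a minimizer.\<close>
  have "\<exists>f \<in> A. J f < \<mu> + 1 / real (Suc n)" for n
    using cINF_less_iff[OF A_ne bdd, of "\<mu> + 1 / real (Suc n)"] by (simp add: \<mu>_def)
  then obtain f where f: "\<And>n. f n \<in> A" "\<And>n. J (f n) < \<mu> + 1 / real (Suc n)" by metis
  have "(\<lambda>n. J (f n)) \<longlonglongrightarrow> \<mu>"
  proof (rule tendsto_sandwich[OF _ _ tendsto_const])
    show "(\<lambda>n. \<mu> + 1 / real (Suc n)) \<longlonglongrightarrow> \<mu>"
      using tendsto_add[OF tendsto_const LIMSEQ_inverse_real_of_nat, of \<mu>]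
      by (simp add: inverse_eq_divide)
    show "\<forall>\<^sub>F n in sequentially. \<mu> \<le> J (f n)"
      by (intro always_eventually allI \<mu>_le f(1))
    show "\<forall>\<^sub>F n in sequentially. J (f n) \<le> \<mu> + 1 / real (Suc n)"
      by (intro always_eventually allI less_imp_le f(2))
  qed
  then have exists_min: "\<exists>ustar \<in> A. m = ereal (J ustar)" using key[of f] f(1) m by auto

  have unique: "(\<lambda>n. ip_norm ip (\<lambda>x. u n x - ustar x)) \<longlonglongrightarrow> 0"
    if uniq: "\<And>w. w \<in> A \<Longrightarrow> m = ereal (J w) \<Longrightarrow> w = ustar"
      and u: "\<And>n. u n \<in> A" and lim: "(\<lambda>n. ereal (J (u n))) \<longlonglongrightarrow> m" for ustar u
  \<comment> \<open>Otherwise a subsequence stays at distance at least \<open>e\<close> from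
    \<open>ustar\<close>. It is still minimizing, so \<open>key\<close> extracts a further
    subsequence converging to a minimizer, which by uniqueness is \<open>ustar\<close>.\<close>
  proof (rule tendstoI, rule ccontr)
    fix e :: real assume e: "e > 0"
    assume "\<not> (\<forall>\<^sub>F n in sequentially. dist (ip_norm ip (\<lambda>x. u n x - ustar x)) 0 < e)"
    then obtain r :: "nat \<Rightarrow> nat" where r: "strict_mono r"
      and far: "\<And>n. \<not> dist (ip_norm ip (\<lambda>x. u (r n) x - ustar x)) 0 < e"
      using not_eventually_sequentiallyD by blast
    have "(\<lambda>n. ereal (J (u (r n)))) \<longlonglongrightarrow> m"
      using LIMSEQ_subseq_LIMSEQ[OF lim r] by (simp add: o_def)
    then obtain r' w where "w \<in> A" "m = ereal (J w)"
      and lim': "(\<lambda>n. ip_norm ip (\<lambda>x. u (r (r' n)) x - w x)) \<longlonglongrightarrow> 0"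
      using key[of "\<lambda>n. u (r n)"] u by blast
    then have "w = ustar" using uniq by blast
    then have "\<forall>\<^sub>F n in sequentially. dist (ip_norm ip (\<lambda>x. u (r (r' n)) x - ustar x)) 0 < e"
      using lim' e tendstoD by blast
    then show False using far by simp
  qed
  show ?thesis
  proof (intro conjI ballI allI impI)
    show "0 \<le> m" "m < \<infinity>" using m \<mu>0 by simp_all
    show "\<exists>ustar \<in> A. m = ereal (J ustar)" by (rule exists_min)
  next
    fix u assume "(\<forall>n. u n \<in> A) \<and> (\<lambda>n. ereal (J (u n))) \<longlonglongrightarrow> m"
    then show "\<exists>r :: nat \<Rightarrow> nat. \<exists>w \<in> A. strict_mono r \<and>
        (\<lambda>n. ip_norm ip (\<lambda>x. u (r n) x - w x)) \<longlonglongrightarrow> 0 \<and> m = ereal (J w)"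
      using key[of u] by blast
  next
    fix ustar u
    assume "m = ereal (J ustar) \<and> (\<forall>w \<in> A. m = ereal (J w) \<longrightarrow> w = ustar)"
      and "(\<forall>n. u n \<in> A) \<and> (\<lambda>n. ereal (J (u n))) \<longlonglongrightarrow> m"
    then show "(\<lambda>n. ip_norm ip (\<lambda>x. u n x - ustar x)) \<longlonglongrightarrow> 0"
      using unique[of ustar u] by blast
  qed
qed

end
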